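(* Let $S=\{\alpha_1,\ldots,\alpha_k\}\subset\mathbb{C}$ be a set of $k$ numbers, each of which is either transcendental or algebraic of degree greater than $k$ over $\mathbb{Q}$, and suppose $S$ is closed under complex conjugation. Then there is a positive integer $n=n(\alpha_1,\ldots,\alpha_k)$, depending only on $\alpha_1,\ldots,\alpha_k$, such that for every $\varepsilon\in(0,1)$ there exists a monic polynomial $F$ of degree $n$ with integer coefficients satisfying $|F(\alpha_i)|<\varepsilon$ for $i=1,\ldots,k$. *)

theory Defs
  imports Complex_Main "HOL-Computational_Algebra.Polynomial"
begin

(* The degree over the rationals of an algebraic number. As with any LEAST, the value is
   unspecified if no such polynomial exists, so this is meaningful for algebraic numbers only. *)
definition rat_degree :: "complex \<Rightarrow> nat" where
  "rat_degree x =
     (LEAST d. \<exists>p :: rat poly. p \<noteq> 0 \<and> poly (map_poly of_rat p) x = 0 \<and> degree p = d)"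

(* poly (map_poly of_rat p) x = 0 for some nonzero p is the library notion algebraic x,
   which is phrased with integer coefficients. *)
lemma algebraic_iff_rat_poly:
  fixes x :: complex
  shows "algebraic x \<longleftrightarrow> (\<exists>p :: rat poly. p \<noteq> 0 \<and> poly (map_poly of_rat p) x = 0)"
proof
  assume "algebraic x"
  then obtain p :: "complex poly" where p: "\<And>i. coeff p i \<in> \<rat>" "p \<noteq> 0" "poly p x = 0"
    unfolding algebraic_altdef by blast
  define f where "f = (\<lambda>c :: complex. THE r :: rat. of_rat r = c)"
  have f: "f (of_rat r) = r" for r
    unfolding f_def by auto
  have f0: "f 0 = 0"
    using f[of 0] by simp
  have "of_rat (f (coeff p i)) = coeff p i" for i
    using p(1)[of i] by (auto elim!: Rats_cases simp: f)
  then have eq: "map_poly of_rat (map_poly f p) = p"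
    by (intro poly_eqI) (simp add: coeff_map_poly f0)
  with p(2) have "map_poly f p \<noteq> 0"
    by auto
  with eq p(3) show "\<exists>p :: rat poly. p \<noteq> 0 \<and> poly (map_poly of_rat p) x = 0"
    by metis
next
  assume "\<exists>p :: rat poly. p \<noteq> 0 \<and> poly (map_poly of_rat p) x = 0"
  then obtain p :: "rat poly" where p: "p \<noteq> 0" "poly (map_poly of_rat p) x = 0"
    by blast
  show "algebraic x"
    by (rule algebraicI'[of "map_poly of_rat p"])
       (use p in \<open>auto simp: coeff_map_poly poly_eq_iff\<close>)
qed

lemma map_poly_of_rat_add:
  "map_poly (of_rat :: rat \<Rightarrow> complex) (p + q) = map_poly of_rat p + map_poly of_rat q"
  by (intro poly_eqI) (simp add: coeff_map_poly of_rat_add)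

lemma map_poly_of_rat_mult:
  "map_poly (of_rat :: rat \<Rightarrow> complex) (p * q) = map_poly of_rat p * map_poly of_rat q"
  by (intro poly_eqI) (simp add: coeff_map_poly coeff_mult of_rat_sum of_rat_mult)

(* rat_degree is the degree of the minimal polynomial. *)
lemma rat_degree_eq_degree_irreducible:
  fixes p :: "rat poly"
  assumes irr: "irreducible p" and root: "poly (map_poly of_rat p) x = 0"
  shows "rat_degree x = degree p"
proof -
  let ?P = "\<lambda>d. \<exists>q :: rat poly. q \<noteq> 0 \<and> poly (map_poly of_rat q) x = 0 \<and> degree q = d"
  have "?P (degree p)"
    using irr root by (auto simp: irreducible_def)
  then have "?P (rat_degree x)"
    unfolding rat_degree_def by (rule LeastI)
  then obtain q :: "rat poly"
    where q: "q \<noteq> 0" "poly (map_poly of_rat q) x = 0" "degree q = rat_degree x"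
    by blast
  have "poly (map_poly of_rat (q * (p div q) + p mod q)) x = 0"
    using root by simp
  then have r: "poly (map_poly of_rat (p mod q)) x = 0"
    unfolding map_poly_of_rat_add map_poly_of_rat_mult using q(2) by simp
  have "p mod q = 0"
  proof (rule ccontr)
    assume nz: "p mod q \<noteq> 0"
    then have "rat_degree x \<le> degree (p mod q)"
      unfolding rat_degree_def using r by (intro Least_le) blast
    moreover have "degree (p mod q) < degree q"
      using degree_mod_less[OF q(1), of p] nz by simp
    ultimately show False
      using q(3) by simp
  qed
  then obtain s where s: "p = q * s"
    by auto
  have "\<not> q dvd 1"
  proof
    assume "q dvd 1"
    then obtain c where "q = [:c:]" "c \<noteq> 0"
      using q(1) by (auto simp: is_unit_poly_iff)
    with q(2) show False
      by (simp add: map_poly_pCons)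
  qed
  with irr s have "s dvd 1"
    by (auto dest: irreducibleD)
  then have "degree s = 0" "s \<noteq> 0"
    by (auto simp: is_unit_poly_iff)
  with s q(1,3) show ?thesis
    by (simp add: degree_mult_eq)
qed

end

theory Submission
  imports Defs "HOL-Analysis.Kronecker_Approximation_Theorem"
begin

text \<open>
  Let \<open>M\<close> be the monic real polynomial of degree \<open>k\<close> with zero set \<open>S\<close>. Simultaneous Dirichlet
  approximation of its coefficients gives \<open>q > 0\<close> such that \<open>q M\<close> is coefficientwise close to an
  integer polynomial \<open>H\<close> of degree \<open>k\<close>, so \<open>H\<close> is tiny on \<open>S\<close>; yet \<open>H\<close> vanishes nowhere on \<open>S\<close>
  by the degree assumption. Hence some real polynomial \<open>P\<close> of degree at most \<open>k\<close> interpolates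
  \<open>- \<alpha> ^ n / H(\<alpha>)\<close> on \<open>S\<close>, where \<open>n = 2k + 1\<close>. Rounding the coefficients of \<open>P\<close> to obtain an
  integer polynomial \<open>Q\<close> changes \<open>X ^ n + H P\<close>, which vanishes on \<open>S\<close>, by at most \<open>|H|\<close> times a
  constant, so \<open>X ^ n + H Q\<close> has the required property.
\<close>

lemma map_poly_of_int_add:
  "map_poly (of_int :: int \<Rightarrow> 'a :: ring_1) (p + q) = map_poly of_int p + map_poly of_int q"
  by (intro poly_eqI) (simp add: coeff_map_poly)

lemma map_poly_of_int_mult:
  "map_poly (of_int :: int \<Rightarrow> 'a :: comm_ring_1) (p * q) = map_poly of_int p * map_poly of_int q"
  by (intro poly_eqI) (simp add: coeff_map_poly coeff_mult)

lemma map_poly_of_int_monom: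
  "map_poly (of_int :: int \<Rightarrow> 'a :: ring_1) (monom c n) = monom (of_int c) n"
  by (intro poly_eqI) (simp add: coeff_map_poly)

lemma rat_degree_le_int_poly:
  fixes p :: "int poly"
  assumes "p \<noteq> 0" and "poly (map_poly of_int p) x = 0"
  shows "rat_degree x \<le> degree p"
proof -
  let ?q = "map_poly (of_int :: int \<Rightarrow> rat) p"
  have "map_poly of_rat ?q = (map_poly of_int p :: complex poly)"
    by (intro poly_eqI) (simp add: coeff_map_poly)
  moreover have "?q \<noteq> 0" "degree ?q = degree p"
    using assms(1) by (auto simp: poly_eq_iff coeff_map_poly intro: degree_map_poly)
  ultimately show ?thesis
    unfolding rat_degree_def using assms(2) by (intro Least_le exI[of _ ?q]) simp
qed

lemma algebraic_int_poly_root: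
  fixes p :: "int poly"
  assumes "p \<noteq> 0" and "poly (map_poly of_int p) x = 0"
  shows "algebraic x"
  using assms by (intro algebraicI[of "map_poly of_int p"]) (auto simp: coeff_map_poly poly_eq_iff)

text \<open>Newton's scheme: a new node \<open>a\<close> is handled by adding a multiple of the
  product \<open>L\<close>, which vanishes at the old nodes but not at \<open>a\<close>. The bound
  \<open>card S\<close> is one above the sharp one for nonempty \<open>S\<close>.\<close>

lemma interpolation_exists:
  fixes f :: "'a :: field \<Rightarrow> 'a"
  assumes "finite S"
  shows "\<exists>P. degree P \<le> card S \<and> (\<forall>x\<in>S. poly P x = f x)"
  using assms
proof (induction S rule: finite_induct)
  case empty
  show ?case by (intro exI[of _ 0]) simp
next
  case (insert a S)
  then obtain P where P: "degree P \<le> card S" "\<forall>x\<in>S. poly P x = f x"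
    by blast
  define L where "L = (\<Prod>b\<in>S. [:-b, 1:])"
  have L: "poly L x = (\<Prod>b\<in>S. x - b)" for x
    by (simp add: L_def poly_prod)
  have "poly L a \<noteq> 0"
    using insert.hyps by (auto simp: L)
  moreover have "poly L x = 0" if "x \<in> S" for x
    using insert.hyps(1) that by (auto simp: L)
  moreover have "degree L = card S"
    unfolding L_def by (subst degree_prod_sum_eq) auto
  ultimately show ?case
    using P insert.hyps
    by (intro exI[of _ "P + smult ((f a - poly P a) / poly L a) L"])
       (auto intro!: degree_add_le simp: degree_smult_le[THEN order_trans])
qed

text \<open>Averaging a polynomial with its conjugate keeps conjugation-invariant values.\<close>
lemma poly_map_poly_Re:
  assumes "poly P x = y" and "poly P (cnj x) = cnj y"
  shows "poly (map_poly of_real (map_poly Re P)) x = y"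
proof -
  have "map_poly of_real (map_poly Re P) = smult (1/2) (P + map_poly cnj P)"
    by (intro poly_eqI) (simp add: coeff_map_poly complex_add_cnj)
  then show ?thesis
    using assms by simp
qed

lemma degree_map_poly_le: "f 0 = 0 \<Longrightarrow> degree (map_poly f p) \<le> degree p"
  by (intro degree_le) (simp add: coeff_map_poly coeff_eq_0)

text \<open>The rounding error \<delta> is a parameter because rounding occurs in two regimes: with
  \<delta> small after Dirichlet approximation, and with \<delta> = 1 for an arbitrary real
  polynomial.\<close>

lemma poly_round_diff_le:
  fixes R :: "real poly" and z :: complex
  assumes "degree R \<le> d" and "\<And>i. i \<le> d \<Longrightarrow> \<bar>coeff R i - of_int (round (coeff R i))\<bar> \<le> \<delta>"
  shows "cmod (poly (map_poly of_int (map_poly round R)) z - poly (map_poly of_real R) z)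
           \<le> \<delta> * (\<Sum>i\<le>d. cmod z ^ i)"
proof -
  define D :: "complex poly" where "D = map_poly of_int (map_poly round R) - map_poly of_real R"
  have coeff_D: "coeff D i = of_real (of_int (round (coeff R i)) - coeff R i)" for i
    by (simp add: D_def coeff_map_poly)
  have "degree D \<le> d"
    using assms(1) by (intro degree_le) (auto simp: coeff_D coeff_eq_0)
  then have "poly D z = (\<Sum>i\<le>d. coeff D i * z ^ i)"
    unfolding poly_altdef by (intro sum.mono_neutral_left) (auto simp: coeff_eq_0)
  also have "cmod \<dots> \<le> (\<Sum>i\<le>d. \<delta> * cmod z ^ i)"
  proof (intro sum_norm_le)
    fix i assume "i \<in> {..d}"
    then have "cmod (coeff D i) \<le> \<delta>"
      using assms(2)[of i] unfolding coeff_D norm_of_real by (simp add: abs_minus_commute)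
    then show "cmod (coeff D i * z ^ i) \<le> \<delta> * cmod z ^ i"
      by (simp add: norm_mult norm_power mult_right_mono)
  qed
  finally show ?thesis
    by (simp add: D_def sum_distrib_left)
qed

lemma small_int_poly_exists:
  fixes S :: "complex set" and \<delta> :: real
  assumes "finite S" and cnj: "\<And>\<alpha>. \<alpha> \<in> S \<Longrightarrow> cnj \<alpha> \<in> S" and "\<delta> > 0"
  shows "\<exists>H :: int poly. H \<noteq> 0 \<and> degree H \<le> card S \<and>
           (\<forall>\<alpha>\<in>S. cmod (poly (map_poly of_int H) \<alpha>) \<le> \<delta> * (\<Sum>i\<le>card S. cmod \<alpha> ^ i))"
proof -
  define k where "k = card S"
  define L where "L = (\<Prod>b\<in>S. [:-b, 1:])"
  define M where "M = map_poly Re L"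
  have "degree L = k"
    unfolding L_def k_def by (subst degree_prod_sum_eq) auto
  moreover have "lead_coeff L = 1"
    unfolding L_def by (simp add: lead_coeff_prod)
  ultimately have coeff_M: "coeff M k = 1" and deg_M: "degree M \<le> k"
    using degree_map_poly_le[of Re L] by (auto simp: M_def coeff_map_poly)
  have L_root: "poly L \<alpha> = 0" if "\<alpha> \<in> S" for \<alpha>
    using assms(1) that by (auto simp: L_def poly_prod)
  \<comment> \<open>Since \<open>L\<close> vanishes at both \<alpha> and its conjugate, taking real
    parts of coefficients keeps the root; that \<open>L\<close> itself is real need not be
    shown.\<close>
  have M_root: "poly (map_poly of_real M) \<alpha> = 0" if "\<alpha> \<in> S" for \<alpha>
    unfolding M_def using that cnj L_root by (intro poly_map_poly_Re) auto
  obtain N :: nat where N: "N > 0" "1 / real N < \<delta>"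
    using \<open>\<delta> > 0\<close> by (metis nat_approx_posE of_nat_Suc inverse_eq_divide zero_less_Suc)
  obtain q p where q: "0 < q" and p: "\<And>i. i < k \<Longrightarrow> \<bar>of_int q * coeff M i - of_int (p i)\<bar> < 1 / N"
    using Dirichlet_approx_simult[OF N(1), where n = k and \<theta> = "coeff M"] by blast
  define R where "R = smult (real_of_int q) M"
  define H where "H = map_poly round R"
  have deg_R: "degree R \<le> k"
    using deg_M by (simp add: R_def)
  have close: "\<bar>coeff R i - of_int (round (coeff R i))\<bar> \<le> \<delta>" if "i \<le> k" for i
  proof (cases "i = k")
    case True
    then show ?thesis using coeff_M \<open>\<delta> > 0\<close> by (simp add: R_def)
  next
    case False
    \<comment> \<open>The nearest integer is at least as close as \<open>p i\<close>, so
      \<open>H\<close> can be defined by rounding alone.\<close>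
    have "\<bar>coeff R i - of_int (round (coeff R i))\<bar> \<le> \<bar>coeff R i - of_int (p i)\<bar>"
      by (rule round_diff_minimal)
    also have "\<dots> \<le> \<delta>"
      using p[of i] N(2) that False by (simp add: R_def)
    finally show ?thesis .
  qed
  \<comment> \<open>As \<open>M\<close> is monic, the top coefficient of \<open>R\<close> is the
    integer \<open>q > 0\<close>; rounding preserves it, which rules out
    \<open>H = 0\<close>.\<close>
  have "coeff H k = q"
    by (simp add: H_def R_def coeff_map_poly coeff_M)
  then have "H \<noteq> 0"
    using q by auto
  moreover have "degree H \<le> k"
    unfolding H_def using degree_map_poly_le[of round R] deg_R by simp
  moreover have "cmod (poly (map_poly of_int H) \<alpha>) \<le> \<delta> * (\<Sum>i\<le>k. cmod \<alpha> ^ i)" if "\<alpha> \<in> S" for \<alpha>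
  proof -
    have "map_poly of_real R = smult (of_int q) (map_poly of_real M :: complex poly)"
      by (intro poly_eqI) (simp add: R_def coeff_map_poly)
    then have "poly (map_poly of_real R) \<alpha> = 0"
      using M_root[OF that] by simp
    then show ?thesis
      using poly_round_diff_le[OF deg_R close, of \<alpha>] by (simp add: H_def)
  qed
  ultimately show ?thesis
    unfolding k_def by blast
qed

lemma cnj_poly_of_int: "cnj (poly (map_poly of_int p) x) = poly (map_poly of_int p) (cnj x)"
  by (rule poly_cnj_real) (simp add: coeff_map_poly)

theorem theorem2p2:
  fixes S :: "complex set" and k :: nat
  assumes "finite S" and "card S = k"
    and "\<And>\<alpha>. \<alpha> \<in> S \<Longrightarrow> \<not> algebraic \<alpha> \<or> (algebraic \<alpha> \<and> rat_degree \<alpha> > k)"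
    and "\<And>\<alpha>. \<alpha> \<in> S \<Longrightarrow> cnj \<alpha> \<in> S"
  shows "\<exists>n :: nat. n > 0 \<and>
           (\<forall>\<epsilon> :: real. 0 < \<epsilon> \<and> \<epsilon> < 1 \<longrightarrow>
              (\<exists>F :: int poly. lead_coeff F = 1 \<and> degree F = n \<and>
                 (\<forall>\<alpha>\<in>S. cmod (poly (map_poly of_int F) \<alpha>) < \<epsilon>)))"
proof (intro exI[of _ "2 * k + 1"] conjI allI impI)
  fix \<epsilon> :: real
  assume \<epsilon>: "0 < \<epsilon> \<and> \<epsilon> < 1"
  \<comment> \<open>This exceeds the degree of any product \<open>H * Q\<close> with both factors of
    degree at most \<open>k\<close>, and it does not involve \<epsilon>.\<close>
  define n where "n = 2 * k + 1"
  define s where "s = (\<lambda>z. \<Sum>i\<le>k. cmod z ^ i)"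
  define B where "B = 1 + (\<Sum>\<alpha>\<in>S. s \<alpha>)"
  have s_nonneg: "s z \<ge> 0" for z
    by (simp add: s_def sum_nonneg)
  then have B: "B \<ge> 1"
    by (simp add: B_def sum_nonneg)
  have s_le: "s \<alpha> \<le> B" if "\<alpha> \<in> S" for \<alpha>
    using member_le_sum[OF that, of s] s_nonneg assms(1) by (simp add: B_def)
  \<comment> \<open>Chosen so that the final estimate \<delta> * B * B equals \<epsilon> /
    2.\<close>
  define \<delta> where "\<delta> = \<epsilon> / (2 * B\<^sup>2)"
  have \<delta>: "\<delta> > 0"
    using \<epsilon> B by (simp add: \<delta>_def)
  obtain H :: "int poly" where H: "H \<noteq> 0" "degree H \<le> k"
    and H_small: "\<And>\<alpha>. \<alpha> \<in> S \<Longrightarrow> cmod (poly (map_poly of_int H) \<alpha>) \<le> \<delta> * s \<alpha>"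
    using small_int_poly_exists[OF assms(1,4) \<delta>] unfolding assms(2) s_def by blast
  define h :: "complex \<Rightarrow> complex" where "h = poly (map_poly of_int H)"
  \<comment> \<open>A zero would make \<alpha> algebraic of degree at most \<open>degree H\<close>,
    hence at most \<open>k\<close>.\<close>
  have h_nz: "h \<alpha> \<noteq> 0" if "\<alpha> \<in> S" for \<alpha>
    using assms(3)[OF that] algebraic_int_poly_root[OF H(1)] rat_degree_le_int_poly[OF H(1)] H(2)
    by (force simp: h_def)
  obtain P where P: "degree P \<le> k" "\<And>\<alpha>. \<alpha> \<in> S \<Longrightarrow> poly P \<alpha> = - (\<alpha> ^ n) / h \<alpha>"
    using interpolation_exists[OF assms(1), of "\<lambda>\<alpha>. - (\<alpha> ^ n) / h \<alpha>"] assms(2) by blast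
  define R where "R = map_poly Re P"
  have deg_R: "degree R \<le> k"
    unfolding R_def using degree_map_poly_le[of Re P] P(1) by simp
  \<comment> \<open>The prescribed values respect conjugation because \<open>h\<close> comes from an
    integer polynomial.\<close>
  have R: "poly (map_poly of_real R) \<alpha> = - (\<alpha> ^ n) / h \<alpha>" if "\<alpha> \<in> S" for \<alpha>
    unfolding R_def using that assms(4) P(2)
    by (intro poly_map_poly_Re) (auto simp: h_def cnj_poly_of_int)
  define Q where "Q = map_poly round R"
  have deg_Q: "degree Q \<le> k"
    unfolding Q_def using degree_map_poly_le[of round R] deg_R by simp
  define F where "F = monom 1 n + H * Q"
  have deg_HQ: "degree (H * Q) < n"
    using degree_mult_le[of H Q] H(2) deg_Q by (simp add: n_def)
  then have deg_F: "degree F = n"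
    unfolding F_def by (subst degree_add_eq_left) (auto simp: degree_monom_eq)
  moreover have "lead_coeff F = 1"
    using deg_HQ unfolding deg_F by (simp add: F_def coeff_eq_0)
  moreover have "cmod (poly (map_poly of_int F) \<alpha>) < \<epsilon>" if \<alpha>: "\<alpha> \<in> S" for \<alpha>
  proof -
    define e where "e = poly (map_poly of_int Q) \<alpha> - poly (map_poly of_real R) \<alpha>"
    have "\<bar>coeff R i - of_int (round (coeff R i))\<bar> \<le> 1" for i
      using of_int_round_abs_le[of "coeff R i"] by (simp add: abs_minus_commute)
    from poly_round_diff_le[OF deg_R this, of \<alpha>] have e: "cmod e \<le> B"
      using s_le[OF \<alpha>] by (simp add: e_def Q_def s_def)
    have "poly (map_poly of_int F) \<alpha> = \<alpha> ^ n + h \<alpha> * poly (map_poly of_int Q) \<alpha>"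
      by (simp add: F_def h_def map_poly_of_int_add map_poly_of_int_mult map_poly_of_int_monom
          poly_monom)
    \<comment> \<open>By interpolation \<open>h\<close> times the value of \<open>R\<close> cancels
      the power of \<alpha>. Only the rounding error \<open>e\<close> survives, so the size of the
      coefficients of \<open>R\<close>, which may grow as \<epsilon> shrinks, never enters.\<close>
    also have "\<dots> = h \<alpha> * e"
      using h_nz[OF \<alpha>] by (simp add: e_def R[OF \<alpha>] algebra_simps)
    also have "cmod \<dots> \<le> (\<delta> * B) * B"
      unfolding norm_mult using H_small[OF \<alpha>] s_le[OF \<alpha>] \<delta> B e
      by (intro mult_mono) (auto simp: h_def intro: order_trans mult_left_mono)
    also have "\<dots> < \<epsilon>"
      using \<epsilon> B by (simp add: \<delta>_def power2_eq_square)
    finally show ?thesis .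
  qed
  ultimately show "\<exists>F :: int poly. lead_coeff F = 1 \<and> degree F = 2 * k + 1 \<and>
      (\<forall>\<alpha>\<in>S. cmod (poly (map_poly of_int F) \<alpha>) < \<epsilon>)"
    unfolding n_def by blast
qed simp

end
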